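(* Let $T$ be a finite set of independence atoms, each of the form $u\ \bot\ v$ for variables $u,v$ (possibly equal), and let $x,y$ be variables. Then $y\ \bot\ x$ is derivable from $T$ using the Independence Axioms (Symmetry Rule and Constancy Rule) if and only if every team (over every structure) that satisfies all atoms in $T$ also satisfies $y\ \bot\ x$.
   Context: A team $X$ over a structure $M$ is a set of assignments $s$ from a common set of variables into the domain of $M$ (the domain containing all variables under consideration). A team $X$ satisfies the atom $x\ \bot\ y$ if for all $s,s'\in X$ there is $s''\in X$ with $s''(y)=s(y)$ and $s''(x)=s'(x)$. The Independence Axioms are the two rules: (Symmetry Rule) from $x\ \bot\ y$ infer $y\ \bot\ x$; (Constancy Rule) from $x\ \bot\ x$ infer $y\ \bot\ x$. "Derivable from $T$" means obtainable from members of $T$ by finitely many applications of these rules. *)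

theory Defs
  imports "HOL-Library.FuncSet"
begin

datatype (vars: 'v) indep_atom = Indep 'v 'v  (infix "\<bottom>" 55)

inductive derivable :: "'v indep_atom set \<Rightarrow> 'v indep_atom \<Rightarrow> bool"  (infix "\<turnstile>" 50)
  for T :: "'v indep_atom set"
where
  axiom: "\<phi> \<in> T \<Longrightarrow> T \<turnstile> \<phi>"
| symmetry: "T \<turnstile> x \<bottom> y \<Longrightarrow> T \<turnstile> y \<bottom> x"
| constancy: "T \<turnstile> x \<bottom> x \<Longrightarrow> T \<turnstile> y \<bottom> x"

text \<open>
  An assignment from a set \<open>V\<close> of variables into a domain \<open>M\<close> is an element of the
  extensional function space \<open>V \<rightarrow>\<^sub>E M\<close>. Independence atoms contain no non-logical symbols,
  so only the domain \<open>M\<close> of a structure matters. Teams may be empty or infinite.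
\<close>

definition team :: "'m set \<Rightarrow> 'v set \<Rightarrow> ('v \<Rightarrow> 'm) set \<Rightarrow> bool"
  where "team M V X \<longleftrightarrow> X \<subseteq> (V \<rightarrow>\<^sub>E M)"

fun satisfies :: "('v \<Rightarrow> 'm) set \<Rightarrow> 'v indep_atom \<Rightarrow> bool"
  where "satisfies X (x \<bottom> y) \<longleftrightarrow>
    (\<forall>s\<in>X. \<forall>s'\<in>X. \<exists>s''\<in>X. s'' y = s y \<and> s'' x = s' x)"

text \<open>
  Consequence over all structures whose domain is a nonempty subset of the type \<open>'m\<close>, and
  all teams whose variables include those of the atoms involved. HOL cannot quantify over
  types inside a formula, so \<open>'m\<close> plays the role of the universe from which domains are
  drawn. It has to be assumed large enough where this notion is used: over a one-element
  type every atom is valid. Any domain embeds into some infinite type.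
\<close>

definition entails :: "'m itself \<Rightarrow> 'v indep_atom set \<Rightarrow> 'v indep_atom \<Rightarrow> bool"
  where "entails (_ :: 'm itself) T \<phi> \<longleftrightarrow>
    (\<forall>(M :: 'm set) V X. M \<noteq> {} \<longrightarrow> (\<Union>\<psi>\<in>insert \<phi> T. vars \<psi>) \<subseteq> V \<longrightarrow> team M V X \<longrightarrow>
      (\<forall>\<psi>\<in>T. satisfies X \<psi>) \<longrightarrow> satisfies X \<phi>)"

end

(* Completeness: call a variable z constant if z \<bottom> z is derivable. If y \<bottom> x is not
   derivable, then neither x nor y is constant. Consider the team of all assignments that take
   a fixed value on the constant variables and satisfy s x = s y. In this team any two distinct
   non-constant variables other than the pair {x, y} vary independently, so T holds, while
   y \<bottom> x fails because the common value of x and y varies. *)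

theory Submission
  imports Defs
begin

lemma satisfies_symmetry: "satisfies X (u \<bottom> v) \<Longrightarrow> satisfies X (v \<bottom> u)"
  unfolding satisfies.simps by blast

text \<open>Self-independence forces \<open>v\<close> to take a single value on \<open>X\<close>, so
  \<open>s'\<close> itself serves as \<open>s''\<close>.\<close>

lemma satisfies_constancy: "satisfies X (v \<bottom> v) \<Longrightarrow> satisfies X (u \<bottom> v)"
  unfolding satisfies.simps by metis

lemma derivable_sound:
  assumes "T \<turnstile> \<phi>" and "\<forall>\<psi>\<in>T. satisfies X \<psi>"
  shows "satisfies X \<phi>"
  using assms(1)
proof induction
  case (axiom \<phi>)
  then show ?case using assms(2) by blast
next
  case (symmetry u v)
  from symmetry.IH show ?case by (rule satisfies_symmetry)
next
  case (constancy v u)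
  from constancy.IH show ?case by (rule satisfies_constancy)
qed

definition tied_team :: "'m \<Rightarrow> 'v set \<Rightarrow> 'v \<Rightarrow> 'v \<Rightarrow> ('v \<Rightarrow> 'm) set"
  where "tied_team a C x y = {s. (\<forall>z\<in>C. s z = a) \<and> s x = s y}"

text \<open>If \<open>u\<close> is in \<open>C\<close>, take \<open>s\<close>; if \<open>v\<close>
  is, take \<open>s'\<close>. Otherwise one of \<open>u\<close>, \<open>v\<close> lies outside both
  \<open>C\<close> and the tie, and can be reset freely.\<close>

lemma tied_team_satisfies:
  assumes "u \<noteq> v \<or> u \<in> C" and "{u, v} \<noteq> {x, y} \<or> u \<in> C \<or> v \<in> C"
  shows "satisfies (tied_team a C x y) (u \<bottom> v)"
  unfolding satisfies.simps
proof (intro ballI)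
  fix s s' assume s: "s \<in> tied_team a C x y" and s': "s' \<in> tied_team a C x y"
  consider "u \<in> C" | "v \<in> C" | "u \<notin> C" "v \<notin> C" "v \<in> {x, y}" | "u \<notin> C" "v \<notin> C" "v \<notin> {x, y}"
    by blast
  then show "\<exists>s''\<in>tied_team a C x y. s'' v = s v \<and> s'' u = s' u"
  proof cases
    case 1
    then show ?thesis using s s' by (auto simp: tied_team_def)
  next
    case 2
    then show ?thesis using s s' by (auto simp: tied_team_def)
  next
    case 3
    \<comment> \<open>Two distinct variables inside \<open>{x, y}\<close> would exhaust it.\<close>
    then have "u \<notin> {x, y}" "u \<noteq> v" using assms by auto
    then have "s(u := s' u) \<in> tied_team a C x y" "(s(u := s' u)) v = s v"
      using s 3 by (auto simp: tied_team_def)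
    then show ?thesis by (metis fun_upd_same)
  next
    case 4
    then have "s'(v := s v) \<in> tied_team a C x y" "(s'(v := s v)) u = s' u"
      using s' assms by (auto simp: tied_team_def)
    then show ?thesis by (metis fun_upd_same)
  qed
qed

lemma tied_team_not_satisfies:
  assumes "x \<notin> C" "y \<notin> C" and "a \<noteq> b"
  shows "\<not> satisfies (tied_team a C x y) (y \<bottom> x)"
proof
  \<comment> \<open>Each is constant off \<open>C\<close>, hence respects the tie; mixing them would
    need the value \<open>a\<close> at \<open>x\<close> and \<open>b\<close> at
    \<open>y\<close>.\<close>
  let ?s = "\<lambda>_. a" and ?s' = "\<lambda>z. if z \<in> C then a else b"
  have team: "?s \<in> tied_team a C x y" "?s' \<in> tied_team a C x y"
    using assms by (auto simp: tied_team_def)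
  assume "satisfies (tied_team a C x y) (y \<bottom> x)"
  from this[unfolded satisfies.simps, THEN bspec, OF team(1), THEN bspec, OF team(2)]
  obtain s where "s \<in> tied_team a C x y" "s x = ?s x" "s y = ?s' y"
    by blast
  then show False using assms by (auto simp: tied_team_def)
qed

lemma underivable_countermodel:
  assumes "\<not> T \<turnstile> y \<bottom> x" and "a \<noteq> b"
  defines "X \<equiv> tied_team a {z. T \<turnstile> z \<bottom> z} x y"
  shows "\<forall>\<psi>\<in>T. satisfies X \<psi>" and "\<not> satisfies X (y \<bottom> x)"
proof -
  \<comment> \<open>From \<open>y \<bottom> y\<close> the Constancy Rule gives
    \<open>x \<bottom> y\<close>, which Symmetry turns around.\<close>
  have "\<not> T \<turnstile> x \<bottom> x" "\<not> T \<turnstile> y \<bottom> y"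
    using assms(1) by (metis derivable.constancy derivable.symmetry)+
  then show "\<not> satisfies X (y \<bottom> x)"
    unfolding X_def using \<open>a \<noteq> b\<close> by (intro tied_team_not_satisfies) auto
  show "\<forall>\<psi>\<in>T. satisfies X \<psi>"
  proof
    fix \<psi> assume "\<psi> \<in> T"
    obtain u v where \<psi>: "\<psi> = u \<bottom> v" by (cases \<psi>)
    have "T \<turnstile> u \<bottom> v" using \<open>\<psi> \<in> T\<close> \<psi> derivable.axiom by metis
    \<comment> \<open>Otherwise the atom is \<open>y \<bottom> x\<close> or its mirror
      image.\<close>
    moreover have "{u, v} \<noteq> {x, y}"
      using calculation assms(1) derivable.symmetry by (metis doubleton_eq_iff)
    ultimately show "satisfies X \<psi>"
      unfolding \<psi> X_def by (intro tied_team_satisfies) auto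
  qed
qed

theorem theorem4:
  fixes T :: "'v indep_atom set" and x y :: 'v
  assumes "finite T"
    and "infinite (UNIV :: 'm set)"
  shows "T \<turnstile> y \<bottom> x \<longleftrightarrow> entails TYPE('m) T (y \<bottom> x)"
proof
  assume "T \<turnstile> y \<bottom> x"
  then show "entails TYPE('m) T (y \<bottom> x)"
    unfolding entails_def using derivable_sound by blast
next
  assume ent: "entails TYPE('m) T (y \<bottom> x)"
  obtain a b :: 'm where "a \<noteq> b"
    using assms(2) by (metis UNIV_eq_I finite.emptyI finite_insert singletonI)
  \<comment> \<open>With every variable in the domain of assignments, extensionality is void, so the
    countermodel qualifies as a team.\<close>
  have "team (UNIV :: 'm set) UNIV X" for X :: "('v \<Rightarrow> 'm) set"
    by (simp add: team_def PiE_UNIV_domain)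
  then have valid: "satisfies X (y \<bottom> x)" if "\<forall>\<psi>\<in>T. satisfies X \<psi>" for X :: "('v \<Rightarrow> 'm) set"
    using ent that unfolding entails_def by blast
  show "T \<turnstile> y \<bottom> x"
  proof (rule ccontr)
    assume "\<not> T \<turnstile> y \<bottom> x"
    note countermodel = underivable_countermodel[OF this \<open>a \<noteq> b\<close>]
    show False
      using countermodel(2) valid[OF countermodel(1)] by (rule notE)
  qed
qed

end
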